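(* Let $X$ be a real Banach space, $H$ a real Hilbert space (identified with its dual), $K\subseteq H$ a nonempty closed convex set, $F:X\to X^*$ continuously differentiable and $g:X\to H$ twice continuously differentiable. Let $(\bar{x},\bar{\lambda})\in X\times H$ be a KKT point, with associated multiplier set $\mathcal{M}(\bar{x})$, Lagrange function $\mathcal{L}$ and residual $\sigma$. Then the following assertions are equivalent: (a) There are a neighborhood $U$ of $\bar{x}$ and constants $c>0$, $\delta>0$ such that, for all $p=(\alpha,\beta)\in X^*\times H$ with $\|p\|_{X^*\times H}<\delta$, any solution $(x_p,\lambda_p)\in U\times H$ of the perturbed KKT system $$\mathcal{L}(x,\lambda)=\alpha,\qquad \lambda\in\mathcal{N}_K(g(x)-\beta)$$ satisfies the estimate $\|x_p-\bar{x}\|_X+\operatorname{dist}(\lambda_p,\mathcal{M}(\bar{x}))\le c\,\|p\|_{X^*\times H}$. (b) There are a neighborhood $U$ of $\bar{x}$ and constants $c>0$, $\delta>0$ such that, for all $(x,\lambda)\in U\times H$ with $\sigma(x,\lambda)<\delta$, $$\|x-\bar{x}\|_X+\operatorname{dist}(\lambda,\mathcal{M}(\bar{x}))\le c\,\sigma(x,\lambda).$$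
   Context: Derivatives are Fréchet derivatives; $g'(x)^*:H\to X^*$ is the adjoint of $g'(x)$. $P_K$ is the metric projection onto $K$. For $y\in K$, $\mathcal{N}_K(y)=\{\psi\in H:(\psi,z-y)\le 0\ \forall z\in K\}$ is the normal cone; for $y\notin K$, $\mathcal{N}_K(y)=\emptyset$. The Lagrange function is $\mathcal{L}:X\times H\to X^*$, $\mathcal{L}(x,\lambda):=F(x)+g'(x)^*\lambda$. A pair $(\bar{x},\bar{\lambda})\in X\times H$ is a KKT point if $\mathcal{L}(\bar{x},\bar{\lambda})=0$ and $\bar{\lambda}\in\mathcal{N}_K(g(\bar{x}))$. The multiplier set is $\mathcal{M}(\bar{x}):=\{\lambda\in H:(\bar{x},\lambda)\text{ is a KKT point}\}$. The residual mapping is $\sigma(x,\lambda):=\|\mathcal{L}(x,\lambda)\|_{X^*}+\|g(x)-P_K(g(x)+\lambda)\|_H$. The space $X^*\times H$ carries the norm $\|(\alpha,\beta)\|_{X^*\times H}:=\|\alpha\|_{X^*}+\|\beta\|_H$, and $\operatorname{dist}(\cdot,S)$ denotes the distance to the nonempty set $S$ in $H$. *)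

theory Defs
  imports "HOL-Analysis.Analysis"
begin

text \<open>Throughout, the dual space of a normed space \<open>'x\<close> is \<open>'x \<Rightarrow>\<^sub>L real\<close> with its operator
  norm, and a Hilbert space is a type of sort \<open>{real_inner, complete_space}\<close>.\<close>

text \<open>The derivative as an element of the normed space of bounded operators, so that its
  continuity in \<open>x\<close> refers to the operator norm.  It is meaningful only where \<open>f\<close> is
  differentiable; there \<open>frechet_derivative f (at x)\<close> is bounded linear and
  \<open>blinfun_apply (fderiv f x)\<close> equals it.\<close>

definition fderiv ::
  "('a::real_normed_vector \<Rightarrow> 'b::real_normed_vector) \<Rightarrow> 'a \<Rightarrow> 'a \<Rightarrow>\<^sub>L 'b" where
  "fderiv f x = Blinfun (frechet_derivative f (at x))"

lemma has_derivative_fderiv: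
  assumes "f differentiable (at x)"
  shows "(f has_derivative blinfun_apply (fderiv f x)) (at x)"
proof -
  have "(f has_derivative frechet_derivative f (at x)) (at x)"
    using assms by (simp add: frechet_derivative_works)
  then show ?thesis
    by (simp add: fderiv_def bounded_linear_Blinfun_apply has_derivative_bounded_linear)
qed

definition continuously_differentiable ::
  "('a::real_normed_vector \<Rightarrow> 'b::real_normed_vector) \<Rightarrow> bool" where
  "continuously_differentiable f \<longleftrightarrow>
     (\<forall>x. f differentiable (at x)) \<and> continuous_on UNIV (fderiv f)"

definition twice_continuously_differentiable ::
  "('a::real_normed_vector \<Rightarrow> 'b::real_normed_vector) \<Rightarrow> bool" where
  "twice_continuously_differentiable f \<longleftrightarrow>
     continuously_differentiable f \<and> continuously_differentiable (fderiv f)"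

text \<open>The adjoint of \<open>A : X \<rightarrow> H\<close> as a map \<open>H \<rightarrow> X*\<close>, where \<open>H\<close> is identified with its dual:
  \<open>A* lam\<close> is the functional \<open>h \<mapsto> (lam, A h)\<close>.  (The library's \<open>adjoint\<close> needs an inner product
  on both sides.)\<close>

definition dual_adjoint ::
  "('x::real_normed_vector \<Rightarrow>\<^sub>L 'h::real_inner) \<Rightarrow> 'h \<Rightarrow> 'x \<Rightarrow>\<^sub>L real" where
  "dual_adjoint A lam = blinfun_inner_right lam o\<^sub>L A"

lemma dual_adjoint_apply: "blinfun_apply (dual_adjoint A lam) h = lam \<bullet> blinfun_apply A h"
  by (simp add: dual_adjoint_def)

text \<open>The library's \<open>closest_point\<close> is restricted to Heine-Borel, i.e. finite-dimensional, spaces.\<close>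

definition metric_projection :: "'h::real_inner set \<Rightarrow> 'h \<Rightarrow> 'h" where
  "metric_projection K a = arg_min_on (dist a) K"

definition normal_cone :: "'h::real_inner set \<Rightarrow> 'h \<Rightarrow> 'h set" where
  "normal_cone K y = (if y \<in> K then {\<psi>. \<forall>z\<in>K. \<psi> \<bullet> (z - y) \<le> 0} else {})"

definition lagrange ::
  "('x::real_normed_vector \<Rightarrow> 'x \<Rightarrow>\<^sub>L real) \<Rightarrow> ('x \<Rightarrow> 'h::real_inner) \<Rightarrow> 'x \<Rightarrow> 'h \<Rightarrow> 'x \<Rightarrow>\<^sub>L real" where
  "lagrange F g x lam = F x + dual_adjoint (fderiv g x) lam"

definition kkt_point ::
  "('x::real_normed_vector \<Rightarrow> 'x \<Rightarrow>\<^sub>L real) \<Rightarrow> ('x \<Rightarrow> 'h::real_inner) \<Rightarrow> 'h set \<Rightarrow> 'x \<Rightarrow> 'h \<Rightarrow> bool" where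
  "kkt_point F g K x lam \<longleftrightarrow> lagrange F g x lam = 0 \<and> lam \<in> normal_cone K (g x)"

definition multipliers ::
  "('x::real_normed_vector \<Rightarrow> 'x \<Rightarrow>\<^sub>L real) \<Rightarrow> ('x \<Rightarrow> 'h::real_inner) \<Rightarrow> 'h set \<Rightarrow> 'x \<Rightarrow> 'h set" where
  "multipliers F g K x = {lam. kkt_point F g K x lam}"

definition perturbed_kkt ::
  "('x::real_normed_vector \<Rightarrow> 'x \<Rightarrow>\<^sub>L real) \<Rightarrow> ('x \<Rightarrow> 'h::real_inner) \<Rightarrow> 'h set \<Rightarrow>
   ('x \<Rightarrow>\<^sub>L real) \<times> 'h \<Rightarrow> 'x \<Rightarrow> 'h \<Rightarrow> bool" where
  "perturbed_kkt F g K p x lam \<longleftrightarrow>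
     lagrange F g x lam = fst p \<and> lam \<in> normal_cone K (g x - snd p)"

definition residual ::
  "('x::real_normed_vector \<Rightarrow> 'x \<Rightarrow>\<^sub>L real) \<Rightarrow> ('x \<Rightarrow> 'h::real_inner) \<Rightarrow> 'h set \<Rightarrow> 'x \<Rightarrow> 'h \<Rightarrow> real" where
  "residual F g K x lam =
     norm (lagrange F g x lam) + norm (g x - metric_projection K (g x + lam))"

text \<open>The norm that the library puts on a product type is the Euclidean combination of the two
  norms; the space of perturbations carries their sum.\<close>

definition sum_norm :: "'a::real_normed_vector \<times> 'b::real_normed_vector \<Rightarrow> real" where
  "sum_norm p = norm (fst p) + norm (snd p)"

end

theory Submission
  imports Defs
begin

text \<open>The normal cone and the projection describe each other: \<open>\<lambda> \<in> N(y)\<close> says precisely that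
  \<open>y\<close> is the projection of \<open>y + \<lambda>\<close> onto \<open>K\<close>.  This allows passing between perturbed KKT pairs and
  points of small residual, in both directions at a cost that is linear in the size of the
  perturbation.

  If \<open>(x, \<lambda>)\<close> solves the system perturbed by \<open>(\<alpha>, \<beta>)\<close>, then \<open>g x - \<beta>\<close> is the projection of
  \<open>g x - \<beta> + \<lambda>\<close>.  Removing \<open>\<beta>\<close> under the projection moves its value by at most \<open>\<parallel>\<beta>\<parallel>\<close>, since
  projections are nonexpansive, so the residual at \<open>(x, \<lambda>)\<close> is at most twice the size of the
  perturbation (\<open>residual_le_perturbation\<close>).  Hence an error bound in terms of the residual gives
  one in terms of the perturbation.

  In the other direction an arbitrary pair \<open>(x, \<lambda>)\<close> need not solve any perturbed system, because
  \<open>\<lambda>\<close> need not be a normal vector anywhere.  With \<open>\<beta> = g x - P (g x + \<lambda>)\<close>, however, the shifted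
  multiplier \<open>\<lambda> + \<beta>\<close> is the difference between \<open>g x + \<lambda>\<close> and its projection \<open>g x - \<beta>\<close>, hence
  normal there.  The shift changes the Lagrange function by \<open>g'(x)\<^sup>* \<beta>\<close>, which is bounded by a
  multiple of \<open>\<parallel>\<beta>\<parallel>\<close> as long as \<open>g'\<close> is bounded, that is, on a small neighbourhood of the reference
  point (\<open>shifted_multiplier_solves_perturbed_kkt\<close>).  The distance to the multiplier set changes by
  at most \<open>\<parallel>\<beta>\<parallel>\<close>.  Both \<open>\<parallel>\<beta>\<parallel>\<close> and the perturbation are thus controlled by the residual.\<close>

text \<open>By the parallelogram law applied at \<open>a\<close>: the midpoint of \<open>x\<close> and \<open>y\<close> lies in \<open>K\<close>, so it is
  at distance at least \<open>infdist a K\<close> from \<open>a\<close>.  Nearly optimal points are therefore close to each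
  other, which makes minimizing sequences Cauchy.\<close>

lemma dist_near_minimizers_le:
  fixes K :: "'h::real_inner set"
  assumes "convex K" "x \<in> K" "y \<in> K"
    and x: "(dist a x)\<^sup>2 \<le> (infdist a K)\<^sup>2 + e"
    and y: "(dist a y)\<^sup>2 \<le> (infdist a K)\<^sup>2 + e"
  shows "(dist x y)\<^sup>2 \<le> 4 * e"
proof -
  define m where "m = (1/2) *\<^sub>R x + (1/2) *\<^sub>R y"
  have "m \<in> K"
    using assms(1-3) unfolding m_def by (intro convexD) auto
  then have m: "(infdist a K)\<^sup>2 \<le> (dist a m)\<^sup>2"
    by (intro power_mono infdist_le infdist_nonneg)
  have "(dist x y)\<^sup>2 = 2 * (dist a x)\<^sup>2 + 2 * (dist a y)\<^sup>2 - 4 * (dist a m)\<^sup>2"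
    unfolding m_def dist_norm power2_norm_eq_inner
    by (simp add: inner_diff_left inner_diff_right inner_add_left inner_add_right
        inner_commute algebra_simps)
  then show ?thesis
    using x y m by linarith
qed

lemma nearest_point_exists:
  fixes K :: "'h::{real_inner, complete_space} set"
  assumes "K \<noteq> {}" "closed K" "convex K"
  shows "\<exists>y\<in>K. \<forall>z\<in>K. dist a y \<le> dist a z"
proof -
  define d where "d = infdist a K"
  have d0: "d \<ge> 0"
    unfolding d_def by (rule infdist_nonneg)
  have "\<exists>z\<in>K. (dist a z)\<^sup>2 \<le> d\<^sup>2 + 1 / real (Suc n)" for n
  proof -
    have "d < sqrt (d\<^sup>2 + 1 / real (Suc n))"
      using d0 by (intro real_less_rsqrt) simp
    then obtain z where "z \<in> K" "dist a z < sqrt (d\<^sup>2 + 1 / real (Suc n))"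
      using \<open>K \<noteq> {}\<close> by (auto simp: d_def infdist_notempty cINF_less_iff)
    moreover from this have "(dist a z)\<^sup>2 \<le> (sqrt (d\<^sup>2 + 1 / real (Suc n)))\<^sup>2"
      by (intro power_mono) auto
    ultimately show ?thesis
      by auto
  qed
  then obtain s where sK: "\<And>n. s n \<in> K"
    and s: "\<And>n. (dist a (s n))\<^sup>2 \<le> d\<^sup>2 + 1 / real (Suc n)"
    by metis
  have "Cauchy s"
  proof (rule metric_CauchyI)
    fix e :: real assume "e > 0"
    then obtain N where N: "inverse (real (Suc N)) < e\<^sup>2 / 4"
      using reals_Archimedean[of "e\<^sup>2 / 4"] by auto
    have "dist (s m) (s n) < e" if "m \<ge> N" "n \<ge> N" for m n
    proof -
      have le: "(dist a (s k))\<^sup>2 \<le> (infdist a K)\<^sup>2 + 1 / real (Suc N)" if "k \<ge> N" for k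
      proof -
        have "1 / real (Suc k) \<le> 1 / real (Suc N)"
          using that by (intro divide_left_mono) auto
        then show ?thesis
          using s[of k] by (simp add: d_def)
      qed
      have "(dist (s m) (s n))\<^sup>2 \<le> 4 * (1 / real (Suc N))"
        using \<open>convex K\<close> sK sK le[OF that(1)] le[OF that(2)] by (rule dist_near_minimizers_le)
      also have "\<dots> < e\<^sup>2"
        using N by (simp add: inverse_eq_divide)
      finally show ?thesis
        using \<open>e > 0\<close> by (rule power2_less_imp_less[OF _ less_imp_le])
    qed
    then show "\<exists>N. \<forall>m\<ge>N. \<forall>n\<ge>N. dist (s m) (s n) < e"
      by blast
  qed
  then obtain y where y: "s \<longlonglongrightarrow> y"
    by (auto simp: Cauchy_convergent_iff convergent_def)
  have "y \<in> K"
    using \<open>closed K\<close> sK y by (rule closed_sequentially)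
  have "(\<lambda>n. (dist a (s n))\<^sup>2) \<longlonglongrightarrow> (dist a y)\<^sup>2"
    by (intro tendsto_power tendsto_dist tendsto_const y)
  moreover have "(\<lambda>n. d\<^sup>2 + 1 / real (Suc n)) \<longlonglongrightarrow> d\<^sup>2 + 0"
    by (rule tendsto_add[OF tendsto_const LIMSEQ_Suc[OF lim_1_over_n]])
  ultimately have "(dist a y)\<^sup>2 \<le> d\<^sup>2 + 0"
    by (rule LIMSEQ_le) (intro exI allI impI, rule s)
  then have "(dist a y)\<^sup>2 \<le> d\<^sup>2"
    by simp
  then have "dist a y \<le> d"
    using d0 by (rule power2_le_imp_le)
  then have "dist a y \<le> dist a z" if "z \<in> K" for z
    using infdist_le[OF that, of a] by (simp add: d_def)
  then show ?thesis
    using \<open>y \<in> K\<close> by blast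
qed

lemma metric_projection_nearest:
  fixes K :: "'h::{real_inner, complete_space} set"
  assumes "K \<noteq> {}" "closed K" "convex K"
  shows "metric_projection K a \<in> K \<and> (\<forall>z\<in>K. dist a (metric_projection K a) \<le> dist a z)"
proof -
  obtain y where "y \<in> K" "\<forall>z\<in>K. dist a y \<le> dist a z"
    using nearest_point_exists[OF assms] by blast
  then have "is_arg_min (dist a) (\<lambda>x. x \<in> K) y"
    by (auto simp: is_arg_min_linorder)
  then have "is_arg_min (dist a) (\<lambda>x. x \<in> K) (metric_projection K a)"
    unfolding metric_projection_def arg_min_on_def arg_min_def by (rule someI)
  then show ?thesis
    by (auto simp: is_arg_min_linorder)
qed

text \<open>Moving from the projection \<open>y\<close> a small fraction \<open>t\<close> of the way to \<open>z\<close> stays in \<open>K\<close>.  If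
  \<open>a - y\<close> made an acute angle with \<open>z - y\<close>, this would decrease the distance to \<open>a\<close>.\<close>

lemma projection_defect_in_normal_cone:
  fixes K :: "'h::{real_inner, complete_space} set"
  assumes "K \<noteq> {}" "closed K" "convex K"
  shows "a - metric_projection K a \<in> normal_cone K (metric_projection K a)"
proof -
  define y where "y = metric_projection K a"
  have yK: "y \<in> K" and near: "\<And>z. z \<in> K \<Longrightarrow> dist a y \<le> dist a z"
    using metric_projection_nearest[OF assms, of a] by (auto simp: y_def)
  have "(a - y) \<bullet> (z - y) \<le> 0" if "z \<in> K" for z
  proof (rule ccontr)
    assume "\<not> ?thesis"
    then obtain t where t: "t > 0" "t \<le> 1" "dist (y + t *\<^sub>R (z - y)) a < dist y a"
      using closer_point_lemma[of a y z] by (auto simp: not_le)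
    have "(1 - t) *\<^sub>R y + t *\<^sub>R z \<in> K"
      using \<open>convex K\<close> yK \<open>z \<in> K\<close> t by (intro convexD) auto
    then have "y + t *\<^sub>R (z - y) \<in> K"
      by (simp add: algebra_simps)
    then show False
      using near[of "y + t *\<^sub>R (z - y)"] t(3) by (simp add: dist_commute)
  qed
  then show ?thesis
    using yK by (simp add: normal_cone_def flip: y_def)
qed

text \<open>The normal cone mapping is monotone and its resolvent is therefore nonexpansive: testing
  each normal vector with the base point of the other gives
  \<open>\<parallel>y - z\<parallel>\<^sup>2 \<le> (a - b) \<bullet> (y - z)\<close>.\<close>

lemma normal_cone_base_point_nonexpansive:
  assumes "a - y \<in> normal_cone K y" "b - z \<in> normal_cone K z"
  shows "norm (y - z) \<le> norm (a - b)"
proof -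
  have "y \<in> K" "z \<in> K"
    using assms by (auto simp: normal_cone_def split: if_splits)
  then have "(a - y) \<bullet> (z - y) \<le> 0" "(b - z) \<bullet> (y - z) \<le> 0"
    using assms by (auto simp: normal_cone_def)
  then have "(norm (y - z))\<^sup>2 \<le> (a - b) \<bullet> (y - z)"
    unfolding power2_norm_eq_inner by (simp add: inner_diff_left inner_diff_right inner_commute)
  also have "\<dots> \<le> norm (a - b) * norm (y - z)"
    by (rule norm_cauchy_schwarz)
  finally show ?thesis
    by (cases "y = z") (simp_all add: power2_eq_square)
qed

lemma norm_dual_adjoint_le: "norm (dual_adjoint A lam) \<le> norm A * norm lam"
proof (rule norm_blinfun_bound)
  fix h
  have "norm (blinfun_apply (dual_adjoint A lam) h) \<le> norm lam * norm (blinfun_apply A h)"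
    by (simp add: dual_adjoint_apply Cauchy_Schwarz_ineq2)
  also have "\<dots> \<le> norm lam * (norm A * norm h)"
    by (intro mult_left_mono norm_blinfun) simp
  finally show "norm (blinfun_apply (dual_adjoint A lam) h) \<le> norm A * norm lam * norm h"
    by (simp add: mult_ac)
qed simp

lemma lagrange_add: "lagrange F g x (lam + mu) = lagrange F g x lam + dual_adjoint (fderiv g x) mu"
  by (rule blinfun_eqI) (simp add: lagrange_def dual_adjoint_apply plus_blinfun.rep_eq inner_add_left)

text \<open>One \<open>\<parallel>\<beta>\<parallel>\<close> comes from the shift of the base point, the other from removing the shift under the
  projection.\<close>

lemma residual_le_perturbation:
  fixes K :: "'h::{real_inner, complete_space} set"
  assumes K: "K \<noteq> {}" "closed K" "convex K"
    and kkt: "perturbed_kkt F g K p x lam"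
  shows "residual F g K x lam \<le> 2 * sum_norm p"
proof -
  define \<beta> where "\<beta> = snd p"
  define y where "y = metric_projection K (g x + lam)"
  have "(g x - \<beta> + lam) - (g x - \<beta>) \<in> normal_cone K (g x - \<beta>)"
    using kkt by (simp add: perturbed_kkt_def \<beta>_def)
  then have "norm ((g x - \<beta>) - y) \<le> norm ((g x - \<beta> + lam) - (g x + lam))"
    using projection_defect_in_normal_cone[OF K, of "g x + lam"]
    unfolding y_def by (rule normal_cone_base_point_nonexpansive)
  moreover have "norm (g x - y) \<le> norm ((g x - \<beta>) - y) + norm \<beta>"
    using norm_triangle_ineq[of "(g x - \<beta>) - y" \<beta>] by simp
  ultimately have defect: "norm (g x - y) \<le> 2 * norm \<beta>"
    by simp
  have "residual F g K x lam = norm (fst p) + norm (g x - y)"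
    using kkt by (simp add: residual_def perturbed_kkt_def y_def)
  also have "\<dots> \<le> norm (fst p) + 2 * norm \<beta>"
    using defect by (rule add_left_mono)
  also have "\<dots> \<le> 2 * sum_norm p"
    by (simp add: sum_norm_def \<beta>_def)
  finally show ?thesis .
qed

text \<open>The pair \<open>(x, \<lambda>)\<close> itself solves no perturbed system in general; the projection defect \<open>\<beta>\<close> serves
  both as the perturbation of the constraint and as the correction of the multiplier.\<close>

lemma shifted_multiplier_solves_perturbed_kkt:
  fixes K :: "'h::{real_inner, complete_space} set"
  assumes K: "K \<noteq> {}" "closed K" "convex K"
    and \<beta>: "\<beta> = g x - metric_projection K (g x + lam)"
    and M: "norm (fderiv g x) \<le> M"
  shows "perturbed_kkt F g K (lagrange F g x (lam + \<beta>), \<beta>) x (lam + \<beta>)"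
    and "sum_norm (lagrange F g x (lam + \<beta>), \<beta>) \<le> (M + 1) * residual F g K x lam"
proof -
  have "lam + \<beta> = (g x + lam) - metric_projection K (g x + lam)"
    by (simp add: \<beta>)
  then have "lam + \<beta> \<in> normal_cone K (metric_projection K (g x + lam))"
    using projection_defect_in_normal_cone[OF K, of "g x + lam"] by (simp only:)
  moreover have "g x - \<beta> = metric_projection K (g x + lam)"
    by (simp add: \<beta>)
  ultimately show "perturbed_kkt F g K (lagrange F g x (lam + \<beta>), \<beta>) x (lam + \<beta>)"
    by (simp add: perturbed_kkt_def)
  have M0: "M \<ge> 0"
    using norm_ge_zero M by (rule order_trans)
  have "norm (dual_adjoint (fderiv g x) \<beta>) \<le> M * norm \<beta>"
    using norm_dual_adjoint_le M by (rule order_trans[OF _ mult_right_mono]) simp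
  then have "norm (lagrange F g x (lam + \<beta>)) \<le> norm (lagrange F g x lam) + M * norm \<beta>"
    unfolding lagrange_add by (intro norm_triangle_le) simp
  then have "sum_norm (lagrange F g x (lam + \<beta>), \<beta>)
      \<le> norm (lagrange F g x lam) + (M + 1) * norm \<beta>"
    by (simp add: sum_norm_def algebra_simps)
  also have "\<dots> \<le> (M + 1) * norm (lagrange F g x lam) + (M + 1) * norm \<beta>"
    using M0 by (simp add: algebra_simps)
  also have "\<dots> = (M + 1) * residual F g K x lam"
    by (simp add: residual_def \<beta> algebra_simps)
  finally show "sum_norm (lagrange F g x (lam + \<beta>), \<beta>) \<le> (M + 1) * residual F g K x lam" .
qed

theorem theorem3p1:
  fixes F :: "'x::banach \<Rightarrow> 'x \<Rightarrow>\<^sub>L real"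
    and g :: "'x \<Rightarrow> 'h::{real_inner, complete_space}"
    and K :: "'h set"
    and xbar :: 'x and lambdabar :: 'h
  assumes "K \<noteq> {}" and "closed K" and "convex K"
    and "continuously_differentiable F"
    and "twice_continuously_differentiable g"
    and "kkt_point F g K xbar lambdabar"
  shows
    "(\<exists>U c \<delta>. xbar \<in> interior U \<and> c > 0 \<and> \<delta> > 0 \<and>
        (\<forall>p. sum_norm p < \<delta> \<longrightarrow>
          (\<forall>x\<in>U. \<forall>lam. perturbed_kkt F g K p x lam \<longrightarrow>
            norm (x - xbar) + infdist lam (multipliers F g K xbar) \<le> c * sum_norm p)))
     \<longleftrightarrow>
     (\<exists>U c \<delta>. xbar \<in> interior U \<and> c > 0 \<and> \<delta> > 0 \<and>
        (\<forall>x\<in>U. \<forall>lam. residual F g K x lam < \<delta> \<longrightarrow>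
            norm (x - xbar) + infdist lam (multipliers F g K xbar) \<le> c * residual F g K x lam))"
proof
  let ?D = "\<lambda>lam. infdist lam (multipliers F g K xbar)"
  let ?\<sigma> = "residual F g K"
  assume "\<exists>U c \<delta>. xbar \<in> interior U \<and> c > 0 \<and> \<delta> > 0 \<and>
        (\<forall>p. sum_norm p < \<delta> \<longrightarrow>
          (\<forall>x\<in>U. \<forall>lam. perturbed_kkt F g K p x lam \<longrightarrow>
            norm (x - xbar) + ?D lam \<le> c * sum_norm p))"
  then obtain U c \<delta> where U: "xbar \<in> interior U" and c: "c > 0" and \<delta>: "\<delta> > 0"
    and bound: "\<And>p x lam. sum_norm p < \<delta> \<Longrightarrow> x \<in> U \<Longrightarrow> perturbed_kkt F g K p x lam \<Longrightarrow>
            norm (x - xbar) + ?D lam \<le> c * sum_norm p"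
    by metis
  define M where "M = norm (fderiv g xbar) + 1"
  have M: "M + 1 > 0"
    unfolding M_def using norm_ge_zero[of "fderiv g xbar"] by linarith
  define V where "V = {x. norm (fderiv g x) < M}"
  have "continuous_on UNIV (fderiv g)"
    using assms(5) by (simp add: twice_continuously_differentiable_def continuously_differentiable_def)
  then have "open V"
    unfolding V_def by (intro open_Collect_less continuous_intros)
  then have UV: "xbar \<in> interior (U \<inter> V)"
    using U by (simp add: interior_open) (simp add: V_def M_def)
  have "norm (x - xbar) + ?D lam \<le> (c * (M + 1) + 1) * ?\<sigma> x lam"
    if x: "x \<in> U \<inter> V" and small: "?\<sigma> x lam < \<delta> / (M + 1)" for x lam
  proof -
    define \<beta> where "\<beta> = g x - metric_projection K (g x + lam)"
    define p where "p = (lagrange F g x (lam + \<beta>), \<beta>)"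
    have "norm (fderiv g x) \<le> M"
      using x by (simp add: V_def)
    note shifted = shifted_multiplier_solves_perturbed_kkt
      [where F = F and g = g and x = x and lam = lam, OF assms(1-3) \<beta>_def this]
    have kkt: "perturbed_kkt F g K p x (lam + \<beta>)" and p: "sum_norm p \<le> (M + 1) * ?\<sigma> x lam"
      using shifted by (simp_all only: p_def)
    have "sum_norm p < \<delta>"
      using p small M by (simp add: pos_less_divide_eq mult.commute)
    then have "norm (x - xbar) + ?D (lam + \<beta>) \<le> c * sum_norm p"
      using bound x kkt by blast
    also have "\<dots> \<le> c * ((M + 1) * ?\<sigma> x lam)"
      using c p by simp
    finally have "norm (x - xbar) + ?D (lam + \<beta>) \<le> c * (M + 1) * ?\<sigma> x lam"
      by simp
    moreover have "?D lam \<le> ?D (lam + \<beta>) + norm \<beta>"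
      using infdist_triangle[of lam _ "lam + \<beta>"] by (simp add: dist_norm)
    moreover have "norm \<beta> \<le> ?\<sigma> x lam"
      by (simp add: residual_def \<beta>_def)
    ultimately show ?thesis
      by (simp add: distrib_right)
  qed
  moreover have "c * (M + 1) + 1 > 0" "\<delta> / (M + 1) > 0"
    using c \<delta> M by (simp_all add: add_pos_pos)
  ultimately show "\<exists>U c \<delta>. xbar \<in> interior U \<and> c > 0 \<and> \<delta> > 0 \<and>
        (\<forall>x\<in>U. \<forall>lam. ?\<sigma> x lam < \<delta> \<longrightarrow> norm (x - xbar) + ?D lam \<le> c * ?\<sigma> x lam)"
    using UV by (intro exI[of _ "U \<inter> V"] exI[of _ "c * (M + 1) + 1"] exI[of _ "\<delta> / (M + 1)"]) simp
next
  let ?D = "\<lambda>lam. infdist lam (multipliers F g K xbar)"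
  let ?\<sigma> = "residual F g K"
  assume "\<exists>U c \<delta>. xbar \<in> interior U \<and> c > 0 \<and> \<delta> > 0 \<and>
        (\<forall>x\<in>U. \<forall>lam. ?\<sigma> x lam < \<delta> \<longrightarrow> norm (x - xbar) + ?D lam \<le> c * ?\<sigma> x lam)"
  then obtain U c \<delta> where U: "xbar \<in> interior U" and c: "c > 0" and \<delta>: "\<delta> > 0"
    and bound: "\<And>x lam. x \<in> U \<Longrightarrow> ?\<sigma> x lam < \<delta> \<Longrightarrow> norm (x - xbar) + ?D lam \<le> c * ?\<sigma> x lam"
    by metis
  have "norm (x - xbar) + ?D lam \<le> (2 * c) * sum_norm p"
    if p: "sum_norm p < \<delta> / 2" and x: "x \<in> U" and kkt: "perturbed_kkt F g K p x lam" for p x lam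
  proof -
    have \<sigma>: "?\<sigma> x lam \<le> 2 * sum_norm p"
      using assms(1-3) kkt by (rule residual_le_perturbation)
    then have "norm (x - xbar) + ?D lam \<le> c * ?\<sigma> x lam"
      using p x by (intro bound) auto
    also have "\<dots> \<le> c * (2 * sum_norm p)"
      using c \<sigma> by simp
    finally show ?thesis
      by simp
  qed
  moreover have "2 * c > 0" "\<delta> / 2 > 0"
    using c \<delta> by simp_all
  ultimately show "\<exists>U c \<delta>. xbar \<in> interior U \<and> c > 0 \<and> \<delta> > 0 \<and>
        (\<forall>p. sum_norm p < \<delta> \<longrightarrow>
          (\<forall>x\<in>U. \<forall>lam. perturbed_kkt F g K p x lam \<longrightarrow>
            norm (x - xbar) + ?D lam \<le> c * sum_norm p))"
    using U by (intro exI[of _ U] exI[of _ "2 * c"] exI[of _ "\<delta> / 2"]) simp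
qed

end
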